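(* Let $f_1,\dots,f_m\in C^1(\mathbb{R}^n)$ have gradients that are Lipschitz on $\mathbb{R}^n$ with constants $L_i\ge0$. Fix $\tau>0$, and suppose that the initial sublevel set $\{z\in\mathbb{R}^{n+1}:\Phi_\tau(z)\le\Phi_\tau(z_0)\}$ is compact. If the algorithm described in the context generates an infinite sequence $(z_k)$, and at every nonrestart iteration $b_k\neq0$ and $0\le\mu_k\le\mu_k^\star$, then $$\|\nabla\Phi_\tau(z_k)\|\longrightarrow0.$$
   Context: $\bar L=\sum_{i=1}^m L_i$; $\phi_\tau(r)=\frac{r+\sqrt{r^2+\tau^2}}{2}$; $\Phi_\tau(x,t)=t+\sum_{i=1}^m\phi_\tau(f_i(x)-t)$ on $\mathbb{R}^{n+1}$. At $z_k=(x_k,t_k)$ let $\omega_{i,k}=\sqrt{(f_i(x_k)-t_k)^2+\tau^2}$, $J_k$ the $m\times(n+1)$ matrix with rows $(\nabla f_i(x_k)^T,-1)$, $D_k=\operatorname{diag}(\omega_{1,k}^{-1},\dots,\omega_{m,k}^{-1})$, $\Pi_x=\operatorname{diag}(I_n,0)$, and $P_k=\delta I_{n+1}+\bar L\Pi_x+\frac12J_k^TD_kJ_k$, a symmetric positive definite matrix. Algorithm (fixed $\tau$). Choose $z_0\in\mathbb{R}^{n+1}$, $\tau>0$, $\delta>0$, $\vartheta>1$, $c_1,\rho\in(0,1)$, a tolerance $\varepsilon>0$, and a curvature-response rule (a rule producing vectors $b_k\in\mathbb{R}^{n+1}$). For $k=0,1,2,\dots$: (1) Compute $g_k=\nabla\Phi_\tau(z_k)$;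 stop if $\|g_k\|\le\varepsilon$. (2) Construct $J_k$, $D_k$ and $P_k$. (3) If $k=0$, set $d_k=-P_k^{-1}g_k$. Otherwise set $s_{k-1}=z_k-z_{k-1}$ and generate a nonzero curvature response $b_k$; if $s_{k-1}=0$ or $b_k=0$, restart with $d_k=-P_k^{-1}g_k$. In the remaining case (nonrestart iteration) compute $C_k=s_{k-1}^TP_ks_{k-1}$, $B_k=b_k^TP_k^{-1}b_k$, $\Delta_k=s_{k-1}^Tb_k$, $\chi_k=\Delta_k/\sqrt{C_kB_k}$, $\mathcal{D}_k=\Delta_k+\vartheta\sqrt{C_kB_k}$ (positive), $\varpi_k^2=\frac{1-\chi_k^2}{(\vartheta+\chi_k)^2}$, $\Gamma_0=\frac{\vartheta^2}{\vartheta^2-1}$, $\mu_k^\star=\frac{\Gamma_0-1-\varpi_k^2}{\sqrt{\Gamma_0}+1}$, choose any $\mu_k\in[0,\mu_k^\star]$ (the default enhanced version uses $\mu_k=\mu_k^\star$), and set $$d_k=-P_k^{-1}g_k+\left[\frac{g_k^TP_k^{-1}b_k}{\mathcal{D}_k}-\mu_k\frac{g_k^Ts_{k-1}}{C_k}\right]s_{k-1}-\frac{g_k^Ts_{k-1}}{\mathcal{D}_k}P_k^{-1}b_k.$$ (4) Starting from $\alpha=1$, backtrack $\alpha\leftarrow\rho\alpha$ until the Armijo condition $\Phi_\tau(z_k+\alpha d_k)\le\Phi_\tau(z_k)+c_1\alpha g_k^Td_k$ holds; call the accepted step $\alpha_k$ and set $z_{k+1}=z_k+\alpha_kd_k$.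 *)

theory Defs
  imports "HOL-Analysis.Analysis"
begin

definition grad :: "('a::real_inner \<Rightarrow> real) \<Rightarrow> 'a \<Rightarrow> 'a" where
  "grad f x = (THE D. GDERIV f x :> D)"

lemma grad_eqI:
  assumes "GDERIV f x :> D"
  shows "grad f x = D"
  unfolding grad_def
proof (rule the_equality)
  show "GDERIV f x :> D" by fact
next
  fix E assume "GDERIV f x :> E"
  then have "(\<lambda>h. inner h E) = (\<lambda>h. inner h D)"
    using assms has_derivative_unique unfolding gderiv_def by blast
  then have "inner (E - D) (E - D) = 0"
    by (metis inner_diff_right right_minus_eq)
  then show "E = D" by simp
qed

definition C1 :: "('a::real_inner \<Rightarrow> real) \<Rightarrow> bool" where
  "C1 f \<longleftrightarrow> (\<forall>x. f differentiable (at x)) \<and> continuous_on UNIV (grad f)"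

text \<open>
  With n the size of the index type \<open>'n\<close>, the space \<open>real ^ 'n option\<close> is the Euclidean space of
  dimension n + 1: the point z = (x, t) has x in the coordinates \<open>Some j\<close> and t in the
  coordinate \<open>None\<close>.
\<close>

definition xpart :: "real ^ 'n option \<Rightarrow> real ^ 'n" where
  "xpart z = (\<chi> j. z $ Some j)"

definition tpart :: "real ^ ('n::finite) option \<Rightarrow> real" where
  "tpart z = z $ None"

definition phi :: "real \<Rightarrow> real \<Rightarrow> real" where
  "phi \<tau> r = (r + sqrt (r\<^sup>2 + \<tau>\<^sup>2)) / 2"

definition Phi :: "real \<Rightarrow> ('m::finite \<Rightarrow> real ^ ('n::finite) \<Rightarrow> real) \<Rightarrow> real ^ 'n option \<Rightarrow> real" where
  "Phi \<tau> f z = tpart z + (\<Sum>i\<in>UNIV. phi \<tau> (f i (xpart z) - tpart z))"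

definition omega ::
  "real \<Rightarrow> ('m::finite \<Rightarrow> real ^ ('n::finite) \<Rightarrow> real) \<Rightarrow> real ^ 'n option \<Rightarrow> 'm \<Rightarrow> real" where
  "omega \<tau> f z i = sqrt ((f i (xpart z) - tpart z)\<^sup>2 + \<tau>\<^sup>2)"

definition Jmat ::
  "('m::finite \<Rightarrow> real ^ ('n::finite) \<Rightarrow> real) \<Rightarrow> real ^ 'n option \<Rightarrow> real ^ 'n option ^ 'm" where
  "Jmat f z = (\<chi> i c. case c of Some j \<Rightarrow> grad (f i) (xpart z) $ j | None \<Rightarrow> - 1)"

definition Dmat ::
  "real \<Rightarrow> ('m::finite \<Rightarrow> real ^ ('n::finite) \<Rightarrow> real) \<Rightarrow> real ^ 'n option \<Rightarrow> real ^ 'm ^ 'm" where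
  "Dmat \<tau> f z = (\<chi> i j. if i = j then inverse (omega \<tau> f z i) else 0)"

definition Pi_x :: "real ^ ('n::finite) option ^ 'n option" where
  "Pi_x = (\<chi> a c. if a = c \<and> a \<noteq> None then 1 else 0)"

definition Pmat ::
  "real \<Rightarrow> real \<Rightarrow> ('m::finite \<Rightarrow> real) \<Rightarrow> ('m \<Rightarrow> real ^ ('n::finite) \<Rightarrow> real) \<Rightarrow> real ^ 'n option
    \<Rightarrow> real ^ 'n option ^ 'n option" where
  "Pmat \<tau> \<delta> L f z = \<delta> *\<^sub>R mat 1 + (\<Sum>i\<in>UNIV. L i) *\<^sub>R Pi_x
     + (1/2) *\<^sub>R (transpose (Jmat f z) ** Dmat \<tau> f z ** Jmat f z)"

text \<open>
  The scalars of a nonrestart iteration, as functions of the matrix \<open>P\<close>, the last step \<open>s\<close> and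
  the curvature response \<open>b\<close>.
\<close>

definition Cval :: "real ^ 'd ^ 'd \<Rightarrow> real ^ ('d::finite) \<Rightarrow> real" where
  "Cval P s = s \<bullet> (P *v s)"

definition Bval :: "real ^ 'd ^ 'd \<Rightarrow> real ^ ('d::finite) \<Rightarrow> real" where
  "Bval P b = b \<bullet> (matrix_inv P *v b)"

definition chi :: "real ^ 'd ^ 'd \<Rightarrow> real ^ ('d::finite) \<Rightarrow> real ^ 'd \<Rightarrow> real" where
  "chi P s b = (s \<bullet> b) / sqrt (Cval P s * Bval P b)"

definition Dval :: "real \<Rightarrow> real ^ 'd ^ 'd \<Rightarrow> real ^ ('d::finite) \<Rightarrow> real ^ 'd \<Rightarrow> real" where
  "Dval \<theta> P s b = s \<bullet> b + \<theta> * sqrt (Cval P s * Bval P b)"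

definition varpi_sq :: "real \<Rightarrow> real ^ 'd ^ 'd \<Rightarrow> real ^ ('d::finite) \<Rightarrow> real ^ 'd \<Rightarrow> real" where
  "varpi_sq \<theta> P s b = (1 - (chi P s b)\<^sup>2) / (\<theta> + chi P s b)\<^sup>2"

definition Gamma0 :: "real \<Rightarrow> real" where
  "Gamma0 \<theta> = \<theta>\<^sup>2 / (\<theta>\<^sup>2 - 1)"

definition mu_star :: "real \<Rightarrow> real ^ 'd ^ 'd \<Rightarrow> real ^ ('d::finite) \<Rightarrow> real ^ 'd \<Rightarrow> real" where
  "mu_star \<theta> P s b = (Gamma0 \<theta> - 1 - varpi_sq \<theta> P s b) / (sqrt (Gamma0 \<theta>) + 1)"

definition restart_dir :: "real ^ 'd ^ 'd \<Rightarrow> real ^ ('d::finite) \<Rightarrow> real ^ 'd" where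
  "restart_dir P g = - (matrix_inv P *v g)"

definition nonrestart_dir ::
  "real \<Rightarrow> real \<Rightarrow> real ^ 'd ^ 'd \<Rightarrow> real ^ 'd \<Rightarrow> real ^ 'd \<Rightarrow> real ^ ('d::finite) \<Rightarrow> real ^ 'd" where
  "nonrestart_dir \<theta> \<mu> P g s b =
     - (matrix_inv P *v g)
     + ((g \<bullet> (matrix_inv P *v b)) / Dval \<theta> P s b - \<mu> * ((g \<bullet> s) / Cval P s)) *\<^sub>R s
     - ((g \<bullet> s) / Dval \<theta> P s b) *\<^sub>R (matrix_inv P *v b)"

text \<open>\<open>last_step z k\<close> is \<open>s\<^bsub>k-1\<^esub>\<close>; it is meaningful only for \<open>k > 0\<close>.\<close>

definition last_step :: "(nat \<Rightarrow> real ^ ('d::finite)) \<Rightarrow> nat \<Rightarrow> real ^ 'd" where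
  "last_step z k = z k - z (k - 1)"

definition restart_iter ::
  "(nat \<Rightarrow> real ^ ('d::finite)) \<Rightarrow> (nat \<Rightarrow> real ^ 'd) \<Rightarrow> nat \<Rightarrow> bool" where
  "restart_iter z b k \<longleftrightarrow> k = 0 \<or> last_step z k = 0 \<or> b k = 0"

definition armijo ::
  "(real ^ ('d::finite) \<Rightarrow> real) \<Rightarrow> real \<Rightarrow> real ^ 'd \<Rightarrow> real ^ 'd \<Rightarrow> real \<Rightarrow> bool" where
  "armijo F c z d \<alpha> \<longleftrightarrow> F (z + \<alpha> *\<^sub>R d) \<le> F z + c * \<alpha> * (grad F z \<bullet> d)"

definition backtracking_step ::
  "(real ^ ('d::finite) \<Rightarrow> real) \<Rightarrow> real \<Rightarrow> real \<Rightarrow> real ^ 'd \<Rightarrow> real ^ 'd \<Rightarrow> real \<Rightarrow> bool" where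
  "backtracking_step F c \<rho> z d \<alpha> \<longleftrightarrow>
     (\<exists>j. \<alpha> = \<rho> ^ j \<and> armijo F c z d (\<rho> ^ j) \<and> (\<forall>i<j. \<not> armijo F c z d (\<rho> ^ i)))"

text \<open>
  \<open>z\<close> is an infinite sequence of iterates: the stopping test never succeeds and every line search
  terminates. The curvature-response rule enters only through the vectors \<open>b k\<close> it produces, which
  are arbitrary; the values \<open>b k\<close> and \<open>\<mu> k\<close> are irrelevant at iterations that do not use them.
  The range of \<open>\<mu> k\<close> is not part of this predicate. The tolerance \<open>\<epsilon>\<close> may be 0, meaning that
  the method stops only at an exact stationary point.
\<close>

definition generates ::
  "real \<Rightarrow> real \<Rightarrow> real \<Rightarrow> real \<Rightarrow> real \<Rightarrow> real \<Rightarrow> ('m::finite \<Rightarrow> real)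
    \<Rightarrow> ('m \<Rightarrow> real ^ ('n::finite) \<Rightarrow> real) \<Rightarrow> (nat \<Rightarrow> real ^ 'n option) \<Rightarrow> (nat \<Rightarrow> real)
    \<Rightarrow> (nat \<Rightarrow> real ^ 'n option) \<Rightarrow> bool" where
  "generates \<tau> \<delta> \<theta> c\<^sub>1 \<rho> \<epsilon> L f b \<mu> z \<longleftrightarrow>
     (\<exists>d \<alpha>. \<forall>k.
        \<not> norm (grad (Phi \<tau> f) (z k)) \<le> \<epsilon> \<and>
        d k = (if restart_iter z b k
               then restart_dir (Pmat \<tau> \<delta> L f (z k)) (grad (Phi \<tau> f) (z k))
               else nonrestart_dir \<theta> (\<mu> k) (Pmat \<tau> \<delta> L f (z k)) (grad (Phi \<tau> f) (z k))
                      (last_step z k) (b k)) \<and>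
        backtracking_step (Phi \<tau> f) c\<^sub>1 \<rho> (z k) (d k) (\<alpha> k) \<and>
        z (Suc k) = z k + \<alpha> k *\<^sub>R d k)"

end

theory Submission
  imports Defs
begin

text \<open>
  The directions of the algorithm are uniformly gradient related on the initial sublevel set:
  with \<open>g\<close> the gradient of \<open>\<Phi>\<^sub>\<tau>\<close> at an iterate there and \<open>d\<close> the direction,
  \<open>g \<bullet> d \<le> - a * (norm g)\<^sup>2\<close> and \<open>norm d \<le> A * norm g\<close> with positive constants \<open>a\<close> and \<open>A\<close>
  independent of the iterate, of the response \<open>b\<close> and of the step \<open>s\<close>.

  Descent comes from the skew form of the correction (\<open>inner_nonrestart_dir\<close>): the two terms with
  denominator \<open>Dval\<close> cancel in \<open>g \<bullet> d\<close>, and the \<open>\<mu>\<close> term contributes a nonpositive amount, so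
  that \<open>g \<bullet> d \<le> - g \<bullet> P\<^sup>-\<^sup>1 g\<close>. The matrix \<open>P\<close> is continuous in the iterate, hence bounded on the
  compact sublevel set, say by \<open>M\<close>, and \<open>g \<bullet> P\<^sup>-\<^sup>1 g \<ge> (\<delta> / M\<^sup>2) * (norm g)\<^sup>2\<close>
  (\<open>inverse_form_lower_bound\<close>).

  The bound on \<open>d\<close> (\<open>norm_nonrestart_dir_le\<close>) rests on the parameter \<open>\<theta> > 1\<close>: by the
  Cauchy-Schwarz inequality in the \<open>P\<close> metric, \<open>Dval\<close> is at least
  \<open>(\<theta> - 1) * sqrt (C * B)\<close>, which is at least \<open>(\<theta> - 1) * \<delta>\<close> times the product of the norms of \<open>s\<close> and
  \<open>P\<^sup>-\<^sup>1 b\<close>. That product cancels against the same factors in the numerators, however small \<open>s\<close>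
  and \<open>b\<close> may be. Since also \<open>\<mu> \<le> sqrt \<Gamma>\<^sub>0 - 1\<close> (\<open>mu_star_le\<close>), coercivity \<open>P \<ge> \<delta> I\<close>
  suffices.

  For such directions the convergence of Armijo backtracking is classical
  (\<open>backtracking_gradient_tendsto_0\<close>): uniform continuity of the gradient on a large ball prevents
  short steps wherever the gradient is not small, and long steps at such points lower the objective
  by a fixed amount, which can happen only finitely often.
\<close>

section \<open>Gradients of continuously differentiable functions\<close>

lemma differentiable_imp_GDERIV_grad:
  fixes f :: "'a::euclidean_space \<Rightarrow> real"
  assumes "f differentiable (at x)"
  shows "GDERIV f x :> grad f x"
proof -
  obtain f' where f': "(f has_derivative f') (at x)"
    using assms by (auto simp: differentiable_def)
  then have lin: "linear f'"
    by (rule has_derivative_linear)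
  have "f' h = h \<bullet> (\<Sum>i\<in>Basis. f' i *\<^sub>R i)" for h
  proof -
    have "f' h = f' (\<Sum>i\<in>Basis. (h \<bullet> i) *\<^sub>R i)"
      by (simp add: euclidean_representation)
    also have "\<dots> = (\<Sum>i\<in>Basis. (h \<bullet> i) * f' i)"
      using lin by (simp add: linear_sum linear_cmul)
    finally show ?thesis
      by (simp add: inner_sum_right mult.commute)
  qed
  then have "f' = (\<lambda>h. h \<bullet> (\<Sum>i\<in>Basis. f' i *\<^sub>R i))"
    by (rule ext)
  with f' have "GDERIV f x :> (\<Sum>i\<in>Basis. f' i *\<^sub>R i)"
    unfolding gderiv_def by metis
  then show ?thesis
    using grad_eqI by metis
qed

lemma C1_GDERIV:
  fixes f :: "'a::euclidean_space \<Rightarrow> real"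
  assumes "C1 f"
  shows "GDERIV f x :> grad f x"
  using assms differentiable_imp_GDERIV_grad unfolding C1_def by blast

lemma C1I:
  assumes "\<And>x. GDERIV f x :> G x" and "continuous_on UNIV G"
  shows "C1 f"
proof -
  have "grad f = G"
    using assms(1) grad_eqI by blast
  moreover have "f differentiable (at x)" for x
    using assms(1)[of x] unfolding gderiv_def differentiable_def by blast
  ultimately show ?thesis
    using assms(2) by (simp add: C1_def)
qed

lemma C1_continuous_on:
  assumes "C1 f"
  shows "continuous_on S f"
proof -
  have "f differentiable_on S"
    using assms differentiable_at_withinI unfolding C1_def differentiable_on_def by blast
  then show ?thesis
    by (rule differentiable_imp_continuous_on)
qed

lemma C1_mean_value:
  fixes F :: "'a::euclidean_space \<Rightarrow> real"
  assumes "C1 F" and "0 < \<alpha>"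
  obtains \<xi> where "0 < \<xi>" "\<xi> < \<alpha>" "F (x + \<alpha> *\<^sub>R d) - F x = \<alpha> * (grad F (x + \<xi> *\<^sub>R d) \<bullet> d)"
proof -
  have "((\<lambda>t. F (x + t *\<^sub>R d)) has_real_derivative grad F (x + t *\<^sub>R d) \<bullet> d) (at t)" for t
  proof -
    have "((\<lambda>t. x + t *\<^sub>R d) has_derivative (\<lambda>h. h *\<^sub>R d)) (at t)"
      by (auto intro!: derivative_eq_intros)
    moreover have "(F has_derivative (\<lambda>h. h \<bullet> grad F (x + t *\<^sub>R d))) (at (x + t *\<^sub>R d))"
      using C1_GDERIV[OF assms(1)] unfolding gderiv_def by blast
    ultimately have "((\<lambda>t. F (x + t *\<^sub>R d)) has_derivative
        (\<lambda>h. (h *\<^sub>R d) \<bullet> grad F (x + t *\<^sub>R d))) (at t)"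
      by (rule has_derivative_compose)
    then show ?thesis
      by (simp add: has_field_derivative_def inner_commute mult.commute[of _ "d \<bullet> _"])
  qed
  then have "\<exists>\<xi>. 0 < \<xi> \<and> \<xi> < \<alpha> \<and>
      F (x + \<alpha> *\<^sub>R d) - F (x + 0 *\<^sub>R d) = (\<alpha> - 0) * (grad F (x + \<xi> *\<^sub>R d) \<bullet> d)"
    using MVT2[OF assms(2), of "\<lambda>t. F (x + t *\<^sub>R d)" "\<lambda>t. grad F (x + t *\<^sub>R d) \<bullet> d"] by blast
  then show ?thesis
    using that by auto
qed

section \<open>Backtracking along gradient-related directions\<close>

text \<open>
  By the mean value theorem the decrease over a step differs from its first-order prediction by at
  most the variation of the gradient along the step; the slack \<open>1 - c\<close> of the Armijo test
  absorbs that variation.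
\<close>

lemma armijo_if_small_gradient_variation:
  fixes F :: "real ^ ('d::finite) \<Rightarrow> real"
  assumes "C1 F" and "0 < \<alpha>"
    and var: "\<And>\<xi>. 0 < \<xi> \<Longrightarrow> \<xi> < \<alpha> \<Longrightarrow> norm (grad F (x + \<xi> *\<^sub>R d) - grad F x) \<le> \<kappa>"
    and slack: "\<kappa> * norm d \<le> - (1 - c) * (grad F x \<bullet> d)"
  shows "armijo F c x d \<alpha>"
proof -
  obtain \<xi> where \<xi>: "0 < \<xi>" "\<xi> < \<alpha>"
    and mv: "F (x + \<alpha> *\<^sub>R d) - F x = \<alpha> * (grad F (x + \<xi> *\<^sub>R d) \<bullet> d)"
    using C1_mean_value[OF assms(1,2)] by blast
  have "(grad F (x + \<xi> *\<^sub>R d) - grad F x) \<bullet> d \<le> norm (grad F (x + \<xi> *\<^sub>R d) - grad F x) * norm d"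
    by (rule norm_cauchy_schwarz)
  also have "\<dots> \<le> \<kappa> * norm d"
    using var[OF \<xi>] by (simp add: mult_right_mono)
  also note slack
  finally have "grad F (x + \<xi> *\<^sub>R d) \<bullet> d \<le> c * (grad F x \<bullet> d)"
    by (simp add: inner_diff_left algebra_simps)
  then have "\<alpha> * (grad F (x + \<xi> *\<^sub>R d) \<bullet> d) \<le> \<alpha> * (c * (grad F x \<bullet> d))"
    using \<open>0 < \<alpha>\<close> by (simp add: mult_left_mono)
  with mv show ?thesis
    unfolding armijo_def by (simp add: algebra_simps)
qed

lemma backtracking_step_lower_bound:
  assumes "backtracking_step F c \<rho> x d \<alpha>" and "0 < \<rho>" and "\<rho> < 1"
    and short: "\<And>\<beta>. 0 < \<beta> \<Longrightarrow> \<beta> \<le> 1 \<Longrightarrow> \<beta> < r \<Longrightarrow> armijo F c x d \<beta>"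
  shows "min 1 (\<rho> * r) \<le> \<alpha>"
proof -
  obtain j where \<alpha>: "\<alpha> = \<rho> ^ j" and rej: "\<And>i. i < j \<Longrightarrow> \<not> armijo F c x d (\<rho> ^ i)"
    using assms(1) unfolding backtracking_step_def by blast
  show ?thesis
  proof (cases j)
    case 0
    then show ?thesis using \<alpha> by simp
  next
    case (Suc i)
    then have "\<not> armijo F c x d (\<rho> ^ i)"
      using rej by simp
    then have "r \<le> \<rho> ^ i"
      using short[of "\<rho> ^ i"] assms(2,3) by (force simp: power_le_one)
    then have "\<rho> * r \<le> \<rho> ^ j"
      using Suc assms(2) by simp
    then show ?thesis using \<alpha> by simp
  qed
qed

text \<open>
  As long as the gradient has norm at least \<open>e\<close>, uniform continuity of the gradient on a ball
  containing all trial points keeps the accepted step sizes away from 0, so that each such iteration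
  lowers \<open>F\<close> by a fixed amount. Since \<open>F\<close> is bounded below on its sublevel set, this happens
  only finitely often. The two conditions on the directions are only demanded inside the sublevel
  set, because in applications their constants come from its compactness.
\<close>

lemma backtracking_gradient_tendsto_0:
  fixes F :: "real ^ ('d::finite) \<Rightarrow> real"
  assumes "C1 F"
    and "0 < c" and "c < 1" and "0 < \<rho>" and "\<rho> < 1" and "0 < a" and "0 < A"
    and cpt: "compact {w. F w \<le> F (z 0)}"
    and descent: "\<And>k. F (z k) \<le> F (z 0) \<Longrightarrow>
      grad F (z k) \<bullet> d k \<le> - a * (norm (grad F (z k)))\<^sup>2"
    and bound: "\<And>k. F (z k) \<le> F (z 0) \<Longrightarrow> norm (d k) \<le> A * norm (grad F (z k))"
    and step: "\<And>k. backtracking_step F c \<rho> (z k) (d k) (\<alpha> k)"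
    and update: "\<And>k. z (Suc k) = z k + \<alpha> k *\<^sub>R d k"
  shows "(\<lambda>k. norm (grad F (z k))) \<longlonglongrightarrow> 0"
proof -
  define K where "K = {w. F w \<le> F (z 0)}"
  define g where "g k = grad F (z k)" for k
  have \<alpha>_pos: "0 < \<alpha> k" for k
    using step[of k] \<open>0 < \<rho>\<close> by (auto simp: backtracking_step_def)
  have decrease: "c * \<alpha> k * (a * (norm (g k))\<^sup>2) \<le> F (z k) - F (z (Suc k))"
    if "F (z k) \<le> F (z 0)" for k
  proof -
    have "F (z (Suc k)) \<le> F (z k) + c * \<alpha> k * (g k \<bullet> d k)"
      using step[of k] update[of k] by (auto simp: backtracking_step_def armijo_def g_def)
    moreover have "c * \<alpha> k * (g k \<bullet> d k) \<le> c * \<alpha> k * (- a * (norm (g k))\<^sup>2)"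
      using descent[OF that] \<alpha>_pos[of k] \<open>0 < c\<close> unfolding g_def by (intro mult_left_mono) auto
    ultimately show ?thesis by simp
  qed
  have nonneg: "0 \<le> c * \<alpha> k * (a * (norm (g k))\<^sup>2)" for k
    using \<open>0 < c\<close> \<open>0 < a\<close> \<alpha>_pos[of k] by simp
  have in_sublevel: "F (z k) \<le> F (z 0)" for k
  proof (induction k)
    case (Suc k)
    then show ?case using decrease[of k] nonneg[of k] by linarith
  qed simp
  then have zK: "z k \<in> K" for k
    by (simp add: K_def)
  have dec: "decseq (\<lambda>k. F (z k))"
    using decrease[OF in_sublevel] nonneg unfolding decseq_Suc_iff by (smt (verit))
  obtain B where B: "\<And>w. w \<in> K \<Longrightarrow> B \<le> F w"
    using continuous_attains_inf[of K F] cpt zK C1_continuous_on[OF \<open>C1 F\<close>]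
    unfolding K_def by blast
  obtain l where l: "(\<lambda>k. F (z k)) \<longlonglongrightarrow> l"
    using decseq_convergent[OF dec, of B] B zK by blast
  have diff0: "(\<lambda>k. F (z k) - F (z (Suc k))) \<longlonglongrightarrow> 0"
    using tendsto_diff[OF l LIMSEQ_Suc[OF l]] by simp
  have grad_cont: "continuous_on S (grad F)" for S
    using \<open>C1 F\<close> continuous_on_subset unfolding C1_def by blast
  have "bounded (grad F ` K)"
    using compact_continuous_image[OF grad_cont] cpt compact_imp_bounded unfolding K_def by blast
  then obtain G where "0 < G" and G: "\<And>w. w \<in> K \<Longrightarrow> norm (grad F w) \<le> G"
    unfolding bounded_pos by blast
  obtain R where R: "\<And>w. w \<in> K \<Longrightarrow> norm w \<le> R"
    using compact_imp_bounded[OF cpt] unfolding K_def bounded_iff by auto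
  have d_le: "norm (d k) \<le> A * G" for k
    using bound[OF in_sublevel, of k] G[OF zK, of k] \<open>0 < A\<close>
    by (meson less_imp_le mult_left_mono order_trans)
  \<comment> \<open>Trial steps are at most 1, so all trial points stay within \<open>A * G\<close> of the sublevel set.\<close>
  have "uniformly_continuous_on (cball 0 (R + A * G)) (grad F)"
    by (rule compact_uniformly_continuous[OF grad_cont compact_cball])
  note unif = this[unfolded uniformly_continuous_on_def, rule_format]
  show ?thesis
    unfolding g_def[symmetric]
  proof (rule LIMSEQ_I)
    fix e :: real
    assume "0 < e"
    \<comment> \<open>A variation that the slack \<open>1 - c\<close> absorbs while the gradient has norm at least \<open>e\<close>.\<close>
    define \<kappa> where "\<kappa> = (1 - c) * a * e / A"
    have "0 < \<kappa>"
      using \<open>0 < e\<close> \<open>0 < a\<close> \<open>0 < A\<close> \<open>c < 1\<close> by (simp add: \<kappa>_def)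
    then obtain \<eta> where "0 < \<eta>"
      and \<eta>: "\<And>x y. x \<in> cball 0 (R + A * G) \<Longrightarrow> y \<in> cball 0 (R + A * G) \<Longrightarrow> dist y x < \<eta> \<Longrightarrow>
        dist (grad F y) (grad F x) < \<kappa>"
      using unif[of \<kappa>] by blast
    \<comment> \<open>Trial steps below \<open>\<eta> / (A * G)\<close> move the point by less than \<open>\<eta>\<close>; backtracking can undershoot
      this threshold by one factor \<open>\<rho>\<close>, and never starts above 1.\<close>
    define m where "m = min 1 (\<rho> * (\<eta> / (A * G)))"
    have "0 < m"
      using \<open>0 < \<rho>\<close> \<open>0 < \<eta>\<close> \<open>0 < A\<close> \<open>0 < G\<close> by (simp add: m_def)
    have long_step: "m \<le> \<alpha> k" if large: "e \<le> norm (g k)" for k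
      unfolding m_def
    proof (rule backtracking_step_lower_bound[OF step \<open>0 < \<rho>\<close> \<open>\<rho> < 1\<close>])
      fix \<beta> :: real
      assume \<beta>: "0 < \<beta>" "\<beta> \<le> 1" "\<beta> < \<eta> / (A * G)"
      have "\<beta> * (A * G) < \<eta>"
        using \<beta>(3) \<open>0 < A\<close> \<open>0 < G\<close> by (simp add: pos_less_divide_eq)
      show "armijo F c (z k) (d k) \<beta>"
      proof (rule armijo_if_small_gradient_variation[OF \<open>C1 F\<close> \<open>0 < \<beta>\<close>])
        fix \<xi> :: real
        assume \<xi>: "0 < \<xi>" "\<xi> < \<beta>"
        have "\<xi> * norm (d k) \<le> \<beta> * (A * G)"
          using \<xi> d_le[of k] by (intro mult_mono) auto
        moreover have "\<beta> * (A * G) \<le> 1 * (A * G)"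
          using \<beta> \<open>0 < A\<close> \<open>0 < G\<close> by (intro mult_right_mono) auto
        ultimately have "norm (\<xi> *\<^sub>R d k) < \<eta>" "norm (\<xi> *\<^sub>R d k) \<le> A * G"
          using \<xi> \<open>\<beta> * (A * G) < \<eta>\<close> by auto
        moreover from this(2) have "norm (z k + \<xi> *\<^sub>R d k) \<le> R + A * G"
          using R[OF zK[of k]] norm_triangle_ineq[of "z k" "\<xi> *\<^sub>R d k"] by linarith
        moreover have "norm (z k) \<le> R + A * G"
          using R[OF zK[of k]] \<open>0 < A\<close> \<open>0 < G\<close> mult_pos_pos[of A G] by linarith
        ultimately show "norm (grad F (z k + \<xi> *\<^sub>R d k) - grad F (z k)) \<le> \<kappa>"
          using \<eta>[of "z k" "z k + \<xi> *\<^sub>R d k"]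
          unfolding mem_cball_0 dist_norm by simp
      next
        have "\<kappa> * norm (d k) \<le> \<kappa> * (A * norm (g k))"
          using bound[OF in_sublevel, of k] \<open>0 < \<kappa>\<close> by (simp add: g_def)
        also have "\<dots> = (1 - c) * (a * (e * norm (g k)))"
          using \<open>0 < A\<close> by (simp add: \<kappa>_def)
        also have "\<dots> \<le> (1 - c) * (a * (norm (g k))\<^sup>2)"
          using large \<open>c < 1\<close> \<open>0 < a\<close> by (simp add: power2_eq_square mult_left_mono mult_right_mono)
        also have "\<dots> \<le> (1 - c) * (- (g k \<bullet> d k))"
          using descent[OF in_sublevel, of k] \<open>c < 1\<close> unfolding g_def
          by (intro mult_left_mono) auto
        finally show "\<kappa> * norm (d k) \<le> - (1 - c) * (grad F (z k) \<bullet> d k)"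
          unfolding g_def by (simp only: mult_minus_left mult_minus_right)
      qed
    qed
    define q where "q = c * m * (a * e\<^sup>2)"
    have "0 < q"
      using \<open>0 < c\<close> \<open>0 < m\<close> \<open>0 < a\<close> \<open>0 < e\<close> by (simp add: q_def)
    have large_decrease: "q \<le> F (z k) - F (z (Suc k))" if "e \<le> norm (g k)" for k
    proof -
      have "q \<le> c * \<alpha> k * (a * (norm (g k))\<^sup>2)"
        unfolding q_def using long_step[OF that] that \<open>0 < c\<close> \<open>0 < m\<close> \<open>0 < a\<close> \<open>0 < e\<close>
        by (intro mult_mono power_mono) auto
      then show ?thesis
        using decrease[OF in_sublevel, of k] by linarith
    qed
    obtain N where N: "\<And>k. N \<le> k \<Longrightarrow> norm (F (z k) - F (z (Suc k)) - 0) < q"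
      using LIMSEQ_D[OF diff0 \<open>0 < q\<close>] by blast
    have "norm (norm (g k) - 0) < e" if "N \<le> k" for k
      using N[OF that] large_decrease[of k] by fastforce
    then show "\<exists>N. \<forall>k\<ge>N. norm (norm (g k) - 0) < e"
      by blast
  qed
qed

section \<open>Search directions for a coercive symmetric matrix\<close>

lemma invertible_if_coercive:
  fixes P :: "real ^ ('d::finite) ^ 'd"
  assumes "0 < \<delta>" and coercive: "\<And>v. \<delta> * (v \<bullet> v) \<le> v \<bullet> (P *v v)"
  shows "invertible P"
proof -
  have "v = 0" if "P *v v = 0" for v
  proof -
    have "\<delta> * (v \<bullet> v) \<le> 0"
      using coercive[of v] that by simp
    then have "v \<bullet> v \<le> 0"
      using \<open>0 < \<delta>\<close> by (simp add: mult_le_0_iff)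
    then show ?thesis
      using inner_gt_zero_iff[of v] by linarith
  qed
  then show ?thesis
    using invertible_left_inverse matrix_left_invertible_ker by blast
qed

lemma matrix_vector_mult_matrix_inv:
  fixes P :: "real ^ ('d::finite) ^ 'd"
  assumes "invertible P"
  shows "P *v (matrix_inv P *v v) = v"
proof -
  have "P ** matrix_inv P = mat 1"
    using someI_ex[OF assms[unfolded invertible_def]] by (simp add: matrix_inv_def)
  then show ?thesis
    by (simp add: matrix_vector_mul_assoc)
qed

text \<open>
  The form is nonnegative at the residual of the \<open>P\<close>-orthogonal projection of \<open>v\<close> onto \<open>w\<close>.
\<close>

lemma psd_cauchy_schwarz:
  fixes P :: "real ^ ('d::finite) ^ 'd"
  assumes sym: "\<And>v w. v \<bullet> (P *v w) = w \<bullet> (P *v v)"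
    and psd: "\<And>v. 0 \<le> v \<bullet> (P *v v)"
    and pos: "0 < w \<bullet> (P *v w)"
  shows "(v \<bullet> (P *v w))\<^sup>2 \<le> (v \<bullet> (P *v v)) * (w \<bullet> (P *v w))"
proof -
  define t where "t = (v \<bullet> (P *v w)) / (w \<bullet> (P *v w))"
  have "0 \<le> (v - t *\<^sub>R w) \<bullet> (P *v (v - t *\<^sub>R w))"
    by (rule psd)
  also have "\<dots> = v \<bullet> (P *v v) - 2 * t * (v \<bullet> (P *v w)) + t\<^sup>2 * (w \<bullet> (P *v w))"
    using sym[of w v]
    by (simp add: matrix_vector_mult_diff_distrib matrix_vector_mult_scaleR inner_diff_left
        inner_diff_right power2_eq_square algebra_simps)
  also have "\<dots> = v \<bullet> (P *v v) - (v \<bullet> (P *v w))\<^sup>2 / (w \<bullet> (P *v w))"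
    using pos by (simp add: t_def power2_eq_square field_simps)
  finally show ?thesis
    using pos by (simp add: field_simps)
qed

text \<open>
  Since the gradient enters through \<open>p = P\<^sup>-\<^sup>1 g\<close>, all estimates are those of a coercive form at
  \<open>p\<close>: an upper bound \<open>M\<close> on \<open>P\<close> gives \<open>norm g \<le> M * norm p\<close>, which turns coercivity into a lower
  bound for \<open>g \<bullet> P\<^sup>-\<^sup>1 g\<close>.
\<close>

lemma inverse_form_lower_bound:
  fixes P :: "real ^ ('d::finite) ^ 'd"
  assumes "0 < \<delta>" and coercive: "\<And>v. \<delta> * (v \<bullet> v) \<le> v \<bullet> (P *v v)"
    and "0 < M" and upper: "\<And>v. norm (P *v v) \<le> M * norm v"
  shows "\<delta> / M\<^sup>2 * (norm g)\<^sup>2 \<le> g \<bullet> (matrix_inv P *v g)"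
proof -
  define p where "p = matrix_inv P *v g"
  have g: "P *v p = g"
    unfolding p_def using matrix_vector_mult_matrix_inv invertible_if_coercive assms(1,2) by blast
  have "(norm g)\<^sup>2 \<le> (M * norm p)\<^sup>2"
    using upper[of p] g by (intro power_mono) auto
  then have "\<delta> / M\<^sup>2 * (norm g)\<^sup>2 \<le> \<delta> * (p \<bullet> p)"
    using \<open>0 < \<delta>\<close> \<open>0 < M\<close>
    by (simp add: power_mult_distrib power2_norm_eq_inner field_simps)
  also have "\<dots> \<le> g \<bullet> p"
    using coercive[of p] g by (simp add: inner_commute)
  finally show ?thesis
    by (simp add: p_def)
qed

lemma norm_inverse_le:
  fixes P :: "real ^ ('d::finite) ^ 'd"
  assumes "0 < \<delta>" and coercive: "\<And>v. \<delta> * (v \<bullet> v) \<le> v \<bullet> (P *v v)"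
  shows "norm (matrix_inv P *v g) \<le> norm g / \<delta>"
proof -
  define p where "p = matrix_inv P *v g"
  have g: "P *v p = g"
    unfolding p_def using matrix_vector_mult_matrix_inv invertible_if_coercive assms by blast
  have "\<delta> * norm p * norm p \<le> p \<bullet> g"
    using coercive[of p] g by (simp add: power2_norm_eq_inner[symmetric] power2_eq_square)
  also have "\<dots> \<le> norm g * norm p"
    using norm_cauchy_schwarz[of p g] by (simp add: mult.commute)
  finally have "\<delta> * norm p \<le> norm g"
    by (cases "p = 0") simp_all
  then show ?thesis
    using \<open>0 < \<delta>\<close> by (simp add: p_def field_simps)
qed

text \<open>
  The two terms with denominator \<open>Dval\<close> form a skew-symmetric operator applied to \<open>g\<close>, so their
  sum is orthogonal to \<open>g\<close>; only the rank-one \<open>\<mu>\<close> term survives. For \<open>\<mu> \<ge> 0\<close> and positive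
  definite \<open>P\<close> it has the sign that favours descent.
\<close>

lemma inner_nonrestart_dir:
  fixes P :: "real ^ ('d::finite) ^ 'd"
  shows "g \<bullet> nonrestart_dir \<theta> \<mu> P g s b =
    - (g \<bullet> (matrix_inv P *v g)) - \<mu> * (g \<bullet> s)\<^sup>2 / Cval P s"
  unfolding nonrestart_dir_def
  by (simp add: inner_diff_right inner_add_right power2_eq_square algebra_simps)

text \<open>
  For a nonzero step \<open>s\<close> and a nonzero response \<open>b\<close>, everything needed about the scalars of the
  iteration follows from the Cauchy-Schwarz inequality in the \<open>P\<close> metric, applied to \<open>s\<close> and
  \<open>P\<^sup>-\<^sup>1 b\<close>.
\<close>

lemma nonrestart_scalars:
  fixes P :: "real ^ ('d::finite) ^ 'd"
  assumes "0 < \<delta>" and coercive: "\<And>v. \<delta> * (v \<bullet> v) \<le> v \<bullet> (P *v v)"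
    and sym: "\<And>v w. v \<bullet> (P *v w) = w \<bullet> (P *v v)"
    and "s \<noteq> 0" and "b \<noteq> 0"
  shows Cval_lower: "\<delta> * (norm s)\<^sup>2 \<le> Cval P s"
    and abs_chi_le_1: "\<bar>chi P s b\<bar> \<le> 1"
    and Dval_lower: "1 < \<theta> \<Longrightarrow>
      (\<theta> - 1) * (\<delta> * (norm s * norm (matrix_inv P *v b))) \<le> Dval \<theta> P s b"
    and response_nonzero: "matrix_inv P *v b \<noteq> 0"
proof -
  define q where "q = matrix_inv P *v b"
  have b: "P *v q = b"
    unfolding q_def using matrix_vector_mult_matrix_inv invertible_if_coercive assms(1,2) by blast
  have "q \<noteq> 0"
    using b \<open>b \<noteq> 0\<close> by auto
  then show "matrix_inv P *v b \<noteq> 0"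
    by (simp add: q_def)
  have B: "Bval P b = q \<bullet> (P *v q)"
    by (simp add: Bval_def b inner_commute flip: q_def)
  have pos: "0 < v \<bullet> (P *v v)" if "v \<noteq> 0" for v
    using coercive[of v] that \<open>0 < \<delta>\<close> by (smt (verit) inner_gt_zero_iff mult_pos_pos)
  have psd: "0 \<le> v \<bullet> (P *v v)" for v
    using pos[of v] by (cases "v = 0") auto
  show C: "\<delta> * (norm s)\<^sup>2 \<le> Cval P s"
    using coercive[of s] by (simp add: Cval_def power2_norm_eq_inner)
  define E where "E = sqrt (Cval P s * Bval P b)"
  have "0 < Cval P s * Bval P b"
    using pos[OF \<open>s \<noteq> 0\<close>] pos[OF \<open>q \<noteq> 0\<close>] by (simp add: Cval_def B)
  then have "0 < E"
    by (simp add: E_def)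
  have "(s \<bullet> b)\<^sup>2 \<le> Cval P s * Bval P b"
    using psd_cauchy_schwarz[OF sym psd pos[OF \<open>q \<noteq> 0\<close>], of s] by (simp add: Cval_def B b)
  then have cs: "\<bar>s \<bullet> b\<bar> \<le> E"
    unfolding E_def by (metis real_sqrt_abs real_sqrt_le_mono)
  then show "\<bar>chi P s b\<bar> \<le> 1"
    using \<open>0 < E\<close> by (simp add: chi_def abs_divide flip: E_def)
  show "(\<theta> - 1) * (\<delta> * (norm s * norm (matrix_inv P *v b))) \<le> Dval \<theta> P s b" if "1 < \<theta>"
  proof -
    have "\<delta> * (norm q)\<^sup>2 \<le> Bval P b"
      using coercive[of q] by (simp add: B power2_norm_eq_inner)
    with C have "(\<delta> * (norm s)\<^sup>2) * (\<delta> * (norm q)\<^sup>2) \<le> Cval P s * Bval P b"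
      using \<open>0 < \<delta>\<close> psd[of s] by (intro mult_mono) (auto simp: Cval_def)
    then have "(\<delta> * (norm s * norm q))\<^sup>2 \<le> Cval P s * Bval P b"
      by (simp add: power2_eq_square algebra_simps)
    then have "\<delta> * (norm s * norm q) \<le> E"
      unfolding E_def by (rule real_le_rsqrt)
    then have "(\<theta> - 1) * (\<delta> * (norm s * norm q)) \<le> (\<theta> - 1) * E"
      using that by (simp add: mult_left_mono)
    also have "\<dots> \<le> s \<bullet> b + \<theta> * E"
      using cs by (simp add: algebra_simps)
    finally show ?thesis
      by (simp add: Dval_def q_def E_def)
  qed
qed

lemma Gamma0_gt_1:
  assumes "1 < \<theta>"
  shows "1 < Gamma0 \<theta>"
proof -
  have "1 < \<theta>\<^sup>2"
    using assms by (simp add: one_less_power)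
  then show ?thesis
    by (simp add: Gamma0_def field_simps)
qed

text \<open>
  Dropping \<open>\<varpi>\<^sup>2 \<ge> 0\<close> leaves \<open>(\<Gamma>\<^sub>0 - 1) / (sqrt \<Gamma>\<^sub>0 + 1)\<close>, whose numerator is a difference of
  two squares.
\<close>

lemma mu_star_le:
  assumes "1 < \<theta>" and "\<bar>chi P s b\<bar> \<le> 1"
  shows "mu_star \<theta> P s b \<le> sqrt (Gamma0 \<theta>) - 1"
proof -
  have "(chi P s b)\<^sup>2 \<le> 1"
    using assms(2) by (simp add: abs_square_le_1)
  then have "0 \<le> varpi_sq \<theta> P s b"
    by (simp add: varpi_sq_def)
  moreover have "Gamma0 \<theta> - 1 = (sqrt (Gamma0 \<theta>) - 1) * (sqrt (Gamma0 \<theta>) + 1)"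
    using Gamma0_gt_1[OF assms(1)] by (simp add: algebra_simps)
  moreover have "0 < sqrt (Gamma0 \<theta>) + 1"
    using Gamma0_gt_1[OF assms(1)] by (simp add: add_pos_pos)
  ultimately show ?thesis
    unfolding mu_star_def by (simp add: pos_divide_le_eq)
qed

text \<open>
  Each term of the correction is homogeneous of degree 0 in \<open>s\<close> and in \<open>b\<close>, and the lower bounds
  on \<open>Dval\<close> and \<open>Cval\<close> have exactly the degrees of the numerators; hence a bound that depends
  on \<open>\<delta>\<close>, \<open>\<theta>\<close> and \<open>m\<close> only. The summand 1 stems from \<open>P\<^sup>-\<^sup>1 g\<close>, the fraction from the two
  skew terms, and \<open>m\<close> from the \<open>\<mu>\<close> term.
\<close>

lemma norm_nonrestart_dir_le:
  fixes P :: "real ^ ('d::finite) ^ 'd"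
  assumes "0 < \<delta>" and coercive: "\<And>v. \<delta> * (v \<bullet> v) \<le> v \<bullet> (P *v v)"
    and sym: "\<And>v w. v \<bullet> (P *v w) = w \<bullet> (P *v v)"
    and "s \<noteq> 0" and "b \<noteq> 0" and "1 < \<theta>" and "0 \<le> \<mu>" and "\<mu> \<le> m"
  shows "norm (nonrestart_dir \<theta> \<mu> P g s b) \<le> (1 + 2 / (\<theta> - 1) + m) / \<delta> * norm g"
proof -
  define p q where "p = matrix_inv P *v g" and "q = matrix_inv P *v b"
  define C D where "C = Cval P s" and "D = Dval \<theta> P s b"
  have "q \<noteq> 0" and C: "\<delta> * (norm s)\<^sup>2 \<le> C"
    and D: "(\<theta> - 1) * (\<delta> * (norm s * norm q)) \<le> D"
    unfolding C_def D_def q_def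
    using nonrestart_scalars[OF assms(1-5)] \<open>1 < \<theta>\<close> by blast+
  have "0 < norm s" "0 < norm q"
    using \<open>s \<noteq> 0\<close> \<open>q \<noteq> 0\<close> by auto
  then have "0 < (\<theta> - 1) * (\<delta> * (norm s * norm q))" "0 < \<delta> * (norm s)\<^sup>2"
    using \<open>0 < \<delta>\<close> \<open>1 < \<theta>\<close> by auto
  then have "0 < D" "0 < C"
    using C D by linarith+
  have skew: "x * norm s * norm q / D \<le> x / ((\<theta> - 1) * \<delta>)" if "0 \<le> x" for x
  proof -
    have "x * ((\<theta> - 1) * (\<delta> * (norm s * norm q))) \<le> x * D"
      using D that by (rule mult_left_mono)
    then show ?thesis
      using \<open>0 < D\<close> \<open>0 < \<delta>\<close> \<open>1 < \<theta>\<close> by (simp add: field_simps)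
  qed
  have "norm (((g \<bullet> q) / D) *\<^sub>R s) = \<bar>g \<bullet> q\<bar> * norm s / D"
    using \<open>0 < D\<close> by simp
  also have "\<dots> \<le> norm g * norm q * norm s / D"
    using \<open>0 < D\<close> Cauchy_Schwarz_ineq2[of g q]
    by (intro divide_right_mono mult_right_mono) auto
  also have "\<dots> \<le> norm g / ((\<theta> - 1) * \<delta>)"
    using skew[of "norm g"] by (simp add: ac_simps)
  finally have 1: "norm (((g \<bullet> q) / D) *\<^sub>R s) \<le> norm g / ((\<theta> - 1) * \<delta>)" .
  have "norm (((g \<bullet> s) / D) *\<^sub>R q) = \<bar>g \<bullet> s\<bar> * norm q / D"
    using \<open>0 < D\<close> by simp
  also have "\<dots> \<le> norm g * norm s * norm q / D"
    using \<open>0 < D\<close> Cauchy_Schwarz_ineq2[of g s]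
    by (intro divide_right_mono mult_right_mono) auto
  also have "\<dots> \<le> norm g / ((\<theta> - 1) * \<delta>)"
    using skew[of "norm g"] by simp
  finally have 2: "norm (((g \<bullet> s) / D) *\<^sub>R q) \<le> norm g / ((\<theta> - 1) * \<delta>)" .
  have "norm ((\<mu> * ((g \<bullet> s) / C)) *\<^sub>R s) = \<mu> * (\<bar>g \<bullet> s\<bar> * norm s / C)"
    using \<open>0 < C\<close> \<open>0 \<le> \<mu>\<close> by (simp add: abs_mult)
  also have "\<dots> \<le> \<mu> * (norm g * norm s * norm s / (\<delta> * (norm s)\<^sup>2))"
    using \<open>0 < \<delta> * (norm s)\<^sup>2\<close> C \<open>0 \<le> \<mu>\<close> Cauchy_Schwarz_ineq2[of g s]
    by (intro mult_left_mono frac_le mult_right_mono) auto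
  also have "\<dots> = \<mu> * (norm g / \<delta>)"
    using \<open>0 < norm s\<close> by (simp add: power2_eq_square)
  also have "\<dots> \<le> m * (norm g / \<delta>)"
    using \<open>\<mu> \<le> m\<close> \<open>0 < \<delta>\<close> by (intro mult_right_mono) auto
  finally have 3: "norm ((\<mu> * ((g \<bullet> s) / C)) *\<^sub>R s) \<le> m * (norm g / \<delta>)" .
  have "nonrestart_dir \<theta> \<mu> P g s b =
      - p + (((g \<bullet> q) / D) *\<^sub>R s - (\<mu> * ((g \<bullet> s) / C)) *\<^sub>R s) - ((g \<bullet> s) / D) *\<^sub>R q"
    by (simp add: nonrestart_dir_def p_def q_def C_def D_def scaleR_diff_left)
  also have "norm \<dots> \<le> norm p + (norm (((g \<bullet> q) / D) *\<^sub>R s) + norm ((\<mu> * ((g \<bullet> s) / C)) *\<^sub>R s))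
      + norm (((g \<bullet> s) / D) *\<^sub>R q)"
    by (smt (verit) norm_triangle_ineq norm_triangle_ineq4 norm_minus_cancel)
  also have "\<dots> \<le> norm g / \<delta> + (norm g / ((\<theta> - 1) * \<delta>) + m * (norm g / \<delta>))
      + norm g / ((\<theta> - 1) * \<delta>)"
    using norm_inverse_le[OF assms(1,2), of g] unfolding p_def
    by (intro add_mono 1 2 3)
  also have "\<dots> = (1 + 2 / (\<theta> - 1) + m) / \<delta> * norm g"
    using \<open>1 < \<theta>\<close> \<open>0 < \<delta>\<close> by (simp add: add_divide_distrib distrib_right)
  finally show ?thesis .
qed

section \<open>The smoothed objective and its matrix\<close>

lemma bounded_linear_xpart: "bounded_linear (xpart :: real ^ ('n::finite) option \<Rightarrow> real ^ 'n)"
  unfolding linear_conv_bounded_linear[symmetric]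
  by (rule linearI) (simp_all add: xpart_def vec_eq_iff)

lemma bounded_linear_tpart: "bounded_linear (tpart :: real ^ ('n::finite) option \<Rightarrow> real)"
  unfolding tpart_def by (rule bounded_linear_vec_nth)

lemma sum_option_UNIV:
  fixes h :: "('n::finite) option \<Rightarrow> 'a::comm_monoid_add"
  shows "(\<Sum>c\<in>UNIV. h c) = h None + (\<Sum>j\<in>UNIV. h (Some j))"
  by (simp add: UNIV_option_conv sum.reindex)

lemma Jmat_mult:
  "(Jmat f z *v h) $ i = grad (f i) (xpart z) \<bullet> xpart h - tpart h"
  by (simp add: Jmat_def matrix_vector_mult_def sum_option_UNIV inner_vec_def xpart_def tpart_def)

lemma phi_deriv:
  assumes "0 < \<tau>"
  shows "(phi \<tau> has_real_derivative (1 + r / sqrt (r\<^sup>2 + \<tau>\<^sup>2)) / 2) (at r)"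
proof -
  have "0 < r\<^sup>2 + \<tau>\<^sup>2"
    using assms by (simp add: add_nonneg_pos)
  then show ?thesis
    unfolding phi_def
    by (auto intro!: derivative_eq_intros simp: field_simps)
qed

text \<open>
  The entries are the derivatives of \<open>phi\<close> at the residuals, that is, the weights with which the rows
  of the Jacobian enter the gradient of \<open>Phi\<close>.
\<close>

definition phi_weights ::
  "real \<Rightarrow> ('m::finite \<Rightarrow> real ^ ('n::finite) \<Rightarrow> real) \<Rightarrow> real ^ 'n option \<Rightarrow> real ^ 'm" where
  "phi_weights \<tau> f z = (\<chi> i. (1 + (f i (xpart z) - tpart z) / omega \<tau> f z i) / 2)"

lemma omega_pos: "0 < \<tau> \<Longrightarrow> 0 < omega \<tau> f z i"
  by (simp add: omega_def add_nonneg_pos)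

lemma GDERIV_Phi:
  assumes C1: "\<And>i. C1 (f i)" and "0 < \<tau>"
  shows "GDERIV (Phi \<tau> f) z :> axis None 1 + transpose (Jmat f z) *v phi_weights \<tau> f z"
proof -
  have "((\<lambda>w. f i (xpart w) - tpart w) has_derivative (\<lambda>h. (Jmat f z *v h) $ i)) (at z)" for i
  proof -
    have "(f i has_derivative (\<lambda>h. h \<bullet> grad (f i) (xpart z))) (at (xpart z))"
      using C1_GDERIV[OF C1] unfolding gderiv_def by blast
    then have "((\<lambda>w. f i (xpart w)) has_derivative (\<lambda>h. xpart h \<bullet> grad (f i) (xpart z))) (at z)"
      by (rule has_derivative_compose[OF bounded_linear_imp_has_derivative[OF bounded_linear_xpart]])
    from has_derivative_diff[OF this bounded_linear_imp_has_derivative[OF bounded_linear_tpart]]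
    show ?thesis
      by (simp add: Jmat_mult inner_commute)
  qed
  note inner_deriv = this
  have "((\<lambda>w. phi \<tau> (f i (xpart w) - tpart w)) has_derivative
      (\<lambda>h. phi_weights \<tau> f z $ i * (Jmat f z *v h) $ i)) (at z)" for i
    using has_derivative_compose[OF inner_deriv
        phi_deriv[OF \<open>0 < \<tau>\<close>, unfolded has_field_derivative_def]]
    by (simp add: phi_weights_def omega_def)
  then have "(Phi \<tau> f has_derivative
      (\<lambda>h. tpart h + (\<Sum>i\<in>UNIV. phi_weights \<tau> f z $ i * (Jmat f z *v h) $ i))) (at z)"
    unfolding Phi_def[abs_def]
    by (intro has_derivative_add has_derivative_sum
        bounded_linear_imp_has_derivative[OF bounded_linear_tpart]) auto
  moreover have "tpart h + (\<Sum>i\<in>UNIV. phi_weights \<tau> f z $ i * (Jmat f z *v h) $ i) =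
      h \<bullet> (axis None 1 + transpose (Jmat f z) *v phi_weights \<tau> f z)" for h
  proof -
    have "h \<bullet> (transpose (Jmat f z) *v phi_weights \<tau> f z) = (Jmat f z *v h) \<bullet> phi_weights \<tau> f z"
      by (metis dot_lmul_matrix inner_commute transpose_matrix_vector)
    also have "\<dots> = (\<Sum>i\<in>UNIV. phi_weights \<tau> f z $ i * (Jmat f z *v h) $ i)"
      by (simp add: inner_vec_def mult.commute)
    finally show ?thesis
      by (simp add: inner_add_right inner_axis tpart_def del: transpose_matrix_vector)
  qed
  ultimately show ?thesis
    by (simp add: gderiv_def)
qed

lemma continuous_on_Jmat_nth:
  assumes "\<And>i. C1 (f i)"
  shows "continuous_on UNIV (\<lambda>z. Jmat f z $ i $ c)"
proof (cases c)
  case None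
  then show ?thesis by (simp add: Jmat_def)
next
  case (Some j)
  have "continuous_on UNIV (\<lambda>z. grad (f i) (xpart z))"
  proof (rule continuous_on_compose2[of UNIV "grad (f i)" UNIV xpart])
    show "continuous_on UNIV (grad (f i))"
      using assms by (simp add: C1_def)
    show "continuous_on UNIV xpart"
      by (rule bounded_linear.continuous_on[OF bounded_linear_xpart continuous_on_id])
  qed simp
  then show ?thesis
    using Some by (simp add: Jmat_def continuous_on_component)
qed

lemma continuous_on_residual:
  assumes "\<And>i. C1 (f i)"
  shows "continuous_on UNIV (\<lambda>z. f i (xpart z) - tpart z)"
proof (rule continuous_on_diff)
  show "continuous_on UNIV (\<lambda>z. f i (xpart z))"
    using C1_continuous_on[OF assms]
    by (rule continuous_on_compose2)
      (auto intro: bounded_linear.continuous_on[OF bounded_linear_xpart continuous_on_id])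
  show "continuous_on UNIV tpart"
    by (rule bounded_linear.continuous_on[OF bounded_linear_tpart continuous_on_id])
qed

lemma continuous_on_omega:
  assumes "\<And>i. C1 (f i)"
  shows "continuous_on UNIV (\<lambda>z. omega \<tau> f z i)"
  unfolding omega_def by (intro continuous_intros continuous_on_residual assms)

lemma C1_Phi:
  assumes "\<And>i. C1 (f i)" and "0 < \<tau>"
  shows "C1 (Phi \<tau> f)"
proof (rule C1I[OF GDERIV_Phi[OF assms]])
  have weights: "continuous_on UNIV (\<lambda>z. phi_weights \<tau> f z $ i)" for i
    unfolding phi_weights_def
    by (auto intro!: continuous_intros continuous_on_residual continuous_on_omega assms
        simp: less_imp_neq[OF omega_pos[OF assms(2)], symmetric])
  have "continuous_on UNIV (\<lambda>z. transpose (Jmat f z) *v phi_weights \<tau> f z)"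
    unfolding matrix_vector_mult_def transpose_def
    by (auto intro!: continuous_on_vec_lambda continuous_on_sum continuous_on_mult
        continuous_on_Jmat_nth weights assms)
  then show "continuous_on UNIV (\<lambda>z. axis None 1 + transpose (Jmat f z) *v phi_weights \<tau> f z)"
    by (intro continuous_intros)
qed

text \<open>
  In this form \<open>P\<close> is visibly symmetric, and for \<open>v = w\<close> the last two terms are sums of squares with
  nonnegative weights once \<open>L\<close> is nonnegative and \<open>\<tau>\<close> is positive.
\<close>

lemma inner_Pmat:
  "v \<bullet> (Pmat \<tau> \<delta> L f z *v w) = \<delta> * (v \<bullet> w) + (\<Sum>i\<in>UNIV. L i) * (xpart v \<bullet> xpart w)
    + (\<Sum>i\<in>UNIV. inverse (omega \<tau> f z i) * ((Jmat f z *v v) $ i * (Jmat f z *v w) $ i)) / 2"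
proof -
  have Pi: "v \<bullet> (Pi_x *v w) = xpart v \<bullet> xpart w"
  proof -
    have "(Pi_x *v w) $ a = (if a = None then 0 else w $ a)" for a
      by (simp add: Pi_x_def matrix_vector_mult_def if_distrib if_distribR cong: if_cong)
    then show ?thesis
      by (simp add: inner_vec_def sum_option_UNIV xpart_def)
  qed
  have D: "(Dmat \<tau> f z *v y) $ i = inverse (omega \<tau> f z i) * y $ i" for y i
    by (simp add: Dmat_def matrix_vector_mult_def if_distrib if_distribR cong: if_cong)
  have "v \<bullet> ((transpose (Jmat f z) ** Dmat \<tau> f z ** Jmat f z) *v w) =
      v \<bullet> (transpose (Jmat f z) *v (Dmat \<tau> f z *v (Jmat f z *v w)))"
    by (simp add: matrix_vector_mul_assoc matrix_mul_assoc)
  also have "\<dots> = (Jmat f z *v v) \<bullet> (Dmat \<tau> f z *v (Jmat f z *v w))"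
    by (metis dot_lmul_matrix inner_commute transpose_matrix_vector)
  also have "\<dots> = (\<Sum>i\<in>UNIV. inverse (omega \<tau> f z i) * ((Jmat f z *v v) $ i * (Jmat f z *v w) $ i))"
    by (simp add: inner_vec_def D ac_simps)
  finally show ?thesis
    by (simp add: Pmat_def matrix_vector_mult_add_rdistrib scaleR_matrix_vector_assoc[symmetric]
        inner_add_right Pi)
qed

lemma Pmat_symmetric:
  "v \<bullet> (Pmat \<tau> \<delta> L f z *v w) = w \<bullet> (Pmat \<tau> \<delta> L f z *v v)"
  by (simp add: inner_Pmat inner_commute mult.commute)

lemma Pmat_coercive:
  assumes "\<And>i. 0 \<le> L i" and "0 < \<tau>"
  shows "\<delta> * (v \<bullet> v) \<le> v \<bullet> (Pmat \<tau> \<delta> L f z *v v)"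
proof -
  have "0 \<le> (\<Sum>i\<in>UNIV. L i) * (xpart v \<bullet> xpart v)"
    using assms(1) by (simp add: sum_nonneg)
  moreover have "0 \<le> (\<Sum>i\<in>UNIV. inverse (omega \<tau> f z i) * ((Jmat f z *v v) $ i * (Jmat f z *v v) $ i))"
    by (intro sum_nonneg mult_nonneg_nonneg[OF _ zero_le_square])
      (simp add: less_imp_le[OF omega_pos[OF assms(2)]])
  ultimately show ?thesis
    by (simp add: inner_Pmat)
qed

lemma continuous_on_Pmat:
  assumes "\<And>i. C1 (f i)" and "0 < \<tau>"
  shows "continuous_on UNIV (Pmat \<tau> \<delta> L f)"
proof -
  have "continuous_on UNIV (\<lambda>z. inverse (omega \<tau> f z i))" for i
    by (intro continuous_on_inverse continuous_on_omega assms(1))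
      (simp add: less_imp_neq[OF omega_pos[OF assms(2)], symmetric])
  then have "continuous_on UNIV (\<lambda>z. Dmat \<tau> f z $ i $ j)" for i j
    by (cases "i = j") (simp_all add: Dmat_def)
  then have "continuous_on UNIV (\<lambda>z. transpose (Jmat f z) ** Dmat \<tau> f z ** Jmat f z)"
    unfolding matrix_matrix_mult_def transpose_def
    by (auto intro!: continuous_on_vec_lambda continuous_on_sum continuous_on_mult
        continuous_on_Jmat_nth assms)
  then show ?thesis
    unfolding Pmat_def[abs_def] by (intro continuous_intros)
qed

lemma norm_matrix_vector_mult_le:
  fixes A :: "real ^ ('n::finite) ^ ('m::finite)"
  shows "norm (A *v v) \<le> norm A * norm v"
proof -
  have "norm (A *v v) = L2_set (\<lambda>i. \<bar>A $ i \<bullet> v\<bar>) UNIV"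
    by (simp add: norm_vec_def matrix_vector_mul_component)
  also have "\<dots> \<le> L2_set (\<lambda>i. norm (A $ i) * norm v) UNIV"
    by (intro L2_set_mono Cauchy_Schwarz_ineq2) auto
  also have "\<dots> = norm A * norm v"
    by (simp add: L2_set_left_distrib norm_vec_def[of A])
  finally show ?thesis .
qed

lemma Pmat_bounded_on_compact:
  assumes "\<And>i. C1 (f i)" and "0 < \<tau>" and "compact K"
  shows "\<exists>M>0. \<forall>z\<in>K. \<forall>v. norm (Pmat \<tau> \<delta> L f z *v v) \<le> M * norm v"
proof -
  have "bounded (Pmat \<tau> \<delta> L f ` K)"
    by (intro compact_imp_bounded compact_continuous_image assms(3)
        continuous_on_subset[OF continuous_on_Pmat[OF assms(1,2)]]) simp
  then obtain M where "0 < M" and M: "\<And>z. z \<in> K \<Longrightarrow> norm (Pmat \<tau> \<delta> L f z) \<le> M"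
    unfolding bounded_pos by blast
  have "norm (Pmat \<tau> \<delta> L f z *v v) \<le> M * norm v" if "z \<in> K" for z v
  proof -
    have "norm (Pmat \<tau> \<delta> L f z *v v) \<le> norm (Pmat \<tau> \<delta> L f z) * norm v"
      by (rule norm_matrix_vector_mult_le)
    also have "\<dots> \<le> M * norm v"
      using M[OF that] by (simp add: mult_right_mono)
    finally show ?thesis .
  qed
  with \<open>0 < M\<close> show ?thesis
    by blast
qed

section \<open>Convergence of the algorithm\<close>

theorem theorem7p3:
  fixes f :: "'m::finite \<Rightarrow> real ^ ('n::finite) \<Rightarrow> real"
    and L :: "'m \<Rightarrow> real"
    and z b :: "nat \<Rightarrow> real ^ 'n option"
    and \<mu> :: "nat \<Rightarrow> real"
    and \<tau> \<delta> \<theta> c\<^sub>1 \<rho> \<epsilon> :: real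
  assumes "\<And>i. C1 (f i)"
    and "\<And>i. L i \<ge> 0"
    and "\<And>i. (L i)-lipschitz_on UNIV (grad (f i))"
    and "\<tau> > 0" and "\<delta> > 0" and "\<theta> > 1"
    and "0 < c\<^sub>1" and "c\<^sub>1 < 1" and "0 < \<rho>" and "\<rho> < 1" and "\<epsilon> \<ge> 0"
    and "compact {w. Phi \<tau> f w \<le> Phi \<tau> f (z 0)}"
    and "generates \<tau> \<delta> \<theta> c\<^sub>1 \<rho> \<epsilon> L f b \<mu> z"
    and "\<And>k. \<not> restart_iter z b k \<Longrightarrow>
           b k \<noteq> 0 \<and> 0 \<le> \<mu> k \<and> \<mu> k \<le> mu_star \<theta> (Pmat \<tau> \<delta> L f (z k)) (last_step z k) (b k)"
  shows "(\<lambda>k. norm (grad (Phi \<tau> f) (z k))) \<longlonglongrightarrow> 0"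
proof -
  let ?F = "Phi \<tau> f"
  let ?P = "\<lambda>k. Pmat \<tau> \<delta> L f (z k)"
  let ?g = "\<lambda>k. grad (Phi \<tau> f) (z k)"
  obtain d \<alpha> where d: "\<And>k. d k = (if restart_iter z b k then restart_dir (?P k) (?g k)
        else nonrestart_dir \<theta> (\<mu> k) (?P k) (?g k) (last_step z k) (b k))"
    and step: "\<And>k. backtracking_step ?F c\<^sub>1 \<rho> (z k) (d k) (\<alpha> k)"
    and update: "\<And>k. z (Suc k) = z k + \<alpha> k *\<^sub>R d k"
    using assms(13) unfolding generates_def by blast
  note coercive = Pmat_coercive[where L = L, OF assms(2) \<open>0 < \<tau>\<close>]
  obtain M where "0 < M"
    and M: "\<And>w v. w \<in> {w. ?F w \<le> ?F (z 0)} \<Longrightarrow> norm (Pmat \<tau> \<delta> L f w *v v) \<le> M * norm v"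
    using Pmat_bounded_on_compact[of f, OF assms(1) \<open>0 < \<tau>\<close> assms(12), of \<delta> L] by blast
  define m where "m = sqrt (Gamma0 \<theta>) - 1"
  have "0 \<le> m"
    using Gamma0_gt_1[OF \<open>1 < \<theta>\<close>] by (simp add: m_def)
  define a A where "a = \<delta> / M\<^sup>2" and "A = (1 + 2 / (\<theta> - 1) + m) / \<delta>"
  have "0 < a"
    using \<open>0 < \<delta>\<close> \<open>0 < M\<close> by (simp add: a_def)
  have "1 \<le> 1 + 2 / (\<theta> - 1) + m"
    using \<open>0 \<le> m\<close> \<open>1 < \<theta>\<close> by simp
  then have "1 / \<delta> \<le> A"
    unfolding A_def using \<open>0 < \<delta>\<close> by (intro divide_right_mono) auto
  then have "0 < A"
    using \<open>0 < \<delta>\<close> by (smt (verit) divide_pos_pos)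
  have nonrestart: "last_step z k \<noteq> 0" "b k \<noteq> 0" "0 \<le> \<mu> k" "\<mu> k \<le> m"
    if "\<not> restart_iter z b k" for k
  proof -
    show nz: "last_step z k \<noteq> 0" "b k \<noteq> 0"
      using that by (auto simp: restart_iter_def)
    show "0 \<le> \<mu> k"
      using assms(14)[OF that] by blast
    show "\<mu> k \<le> m"
      unfolding m_def
      using assms(14)[OF that] mu_star_le[OF \<open>1 < \<theta>\<close> abs_chi_le_1[OF \<open>0 < \<delta>\<close> coercive Pmat_symmetric nz]]
      by (meson order_trans)
  qed
  show ?thesis
  proof (rule backtracking_gradient_tendsto_0[where F = ?F and d = d and \<alpha> = \<alpha> and \<rho> = \<rho>])
    fix k
    assume sub: "?F (z k) \<le> ?F (z 0)"
    have form: "a * (norm (?g k))\<^sup>2 \<le> ?g k \<bullet> (matrix_inv (?P k) *v ?g k)"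
      unfolding a_def using M sub
      by (intro inverse_form_lower_bound[OF \<open>0 < \<delta>\<close> coercive \<open>0 < M\<close>]) auto
    show "?g k \<bullet> d k \<le> - a * (norm (?g k))\<^sup>2"
    proof (cases "restart_iter z b k")
      case True
      then show ?thesis using form by (simp add: d restart_dir_def)
    next
      case False
      have "0 \<le> Cval (?P k) (last_step z k)"
        using coercive[of \<delta> "last_step z k" f "z k"] \<open>0 < \<delta>\<close>
        by (smt (verit) Cval_def inner_ge_zero mult_nonneg_nonneg)
      then have "0 \<le> \<mu> k * (?g k \<bullet> last_step z k)\<^sup>2 / Cval (?P k) (last_step z k)"
        using nonrestart(3)[OF False] by simp
      then show ?thesis
        using False form by (simp add: d inner_nonrestart_dir)
    qed
    show "norm (d k) \<le> A * norm (?g k)"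
    proof (cases "restart_iter z b k")
      case True
      have "norm (d k) \<le> 1 / \<delta> * norm (?g k)"
        using True norm_inverse_le[OF \<open>0 < \<delta>\<close> coercive] by (simp add: d restart_dir_def)
      also have "\<dots> \<le> A * norm (?g k)"
        using \<open>1 / \<delta> \<le> A\<close> by (rule mult_right_mono) simp
      finally show ?thesis .
    next
      case False
      then show ?thesis
        unfolding A_def
        using norm_nonrestart_dir_le[OF \<open>0 < \<delta>\<close> coercive Pmat_symmetric nonrestart(1,2) \<open>1 < \<theta>\<close>
            nonrestart(3,4)] by (simp add: d)
    qed
  qed (use assms C1_Phi[OF assms(1) \<open>0 < \<tau>\<close>] step update \<open>0 < a\<close> \<open>0 < A\<close> in auto)
qed

end
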